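(* For all integers $r,k\in\mathbb{Z}$ and every integer $n\ge 0$, $$s_{n+1}^{(r,k)}(x)=x\,s_{n}^{(r,k)}(x)-\frac{r}{n+1}\sum_{l=0}^{n}\binom{n+1}{l}(-1)^{n+1-l}B_{n+1-l}\,s_{l}^{(r,k)}(x)-\frac{1}{n+1}\left\{s_{n+1}^{(r+1,k)}(x)-s_{n+1}^{(r+1,k-1)}(x)\right\}$$ as polynomials in $x$.
   Context: For $k\in\mathbb{Z}$, $Li_k(x)=\sum_{n=1}^{\infty}\frac{x^n}{n^k}$ is the polylogarithm, regarded as a formal power series; $\frac{Li_k(1-e^{-t})}{1-e^{-t}}$ is then a formal power series in $t$ over $\mathbb{C}$. The ordinary Bernoulli numbers $B_n$ are defined by $\frac{t}{e^t-1}=\sum_{n\ge0}B_n\frac{t^n}{n!}$ (so $B_1=-\tfrac12$). For $r,k\in\mathbb{Z}$, the higher-order Bernoulli and poly-Bernoulli mixed type polynomials $s_n^{(r,k)}(x)$ are defined by $\left(\frac{t}{e^t-1}\right)^r\frac{Li_k(1-e^{-t})}{1-e^{-t}}e^{xt}=\sum_{n\ge0}s_n^{(r,k)}(x)\frac{t^n}{n!}$. *)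

theory Defs
  imports "HOL-Computational_Algebra.Computational_Algebra" Complex_Main
begin

unbundle fps_syntax

text \<open>
  \<open>Li\<^sub>k\<close> as a formal power series. The constant term is set to \<open>0\<close> explicitly, since the sum
  starts at \<open>n = 1\<close> and \<open>1 / 0 powi k\<close> is not \<open>0\<close> for \<open>k = 0\<close>.
\<close>
definition polylog_fps :: "int \<Rightarrow> complex fps" where
  "polylog_fps k = Abs_fps (\<lambda>n. if n = 0 then 0 else 1 / (of_nat n powi k))"

text \<open>
  In both quotients below the denominator has zero constant term. Division of formal power series
  over a field cancels the common power of the indeterminate, and is exact here; see
  \<open>bernoulli_gf_mult\<close> and \<open>poly_bernoulli_gf_mult\<close>.
\<close>
definition bernoulli_gf :: "complex fps" where
  "bernoulli_gf = fps_X / (fps_exp 1 - 1)"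

definition poly_bernoulli_gf :: "int \<Rightarrow> complex fps" where
  "poly_bernoulli_gf k = (polylog_fps k oo (1 - fps_exp (-1))) / (1 - fps_exp (-1))"

definition bernoulli_number :: "nat \<Rightarrow> complex" where
  "bernoulli_number n = fact n * bernoulli_gf $ n"

text \<open>
  Generating functions that involve \<open>x\<close> are power series in \<open>t\<close> whose coefficients are polynomials
  in \<open>x\<close>; \<open>const_poly_fps\<close> embeds the series that do not involve \<open>x\<close>, and \<open>exp_xt\<close> is \<open>e\<^sup>x\<^sup>t\<close>, with
  coefficients \<open>x\<^sup>n / n!\<close>.
\<close>
definition const_poly_fps :: "complex fps \<Rightarrow> complex poly fps" where
  "const_poly_fps F = Abs_fps (\<lambda>n. [:F $ n:])"

definition exp_xt :: "complex poly fps" where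
  "exp_xt = Abs_fps (\<lambda>n. monom (1 / fact n) n)"

text \<open>
  The integer power is the genuine one also for negative \<open>r\<close>, as \<open>bernoulli_gf\<close> is invertible
  (\<open>bernoulli_gf_nth_0\<close>).
\<close>
definition mixed_poly :: "int \<Rightarrow> int \<Rightarrow> nat \<Rightarrow> complex poly" where
  "mixed_poly r k n =
     smult (fact n) ((const_poly_fps (bernoulli_gf powi r) *
                      const_poly_fps (poly_bernoulli_gf k) * exp_xt) $ n)"

lemma subdegree_fps_exp_minus_1: "subdegree (fps_exp (1::complex) - 1) = 1"
  by (rule subdegreeI) auto

lemma subdegree_1_minus_fps_exp: "subdegree (1 - fps_exp (-1::complex)) = 1"
  by (rule subdegreeI) auto

lemma bernoulli_gf_mult: "bernoulli_gf * (fps_exp 1 - 1) = fps_X"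
proof -
  have "(fps_exp (1::complex) - 1) dvd fps_X"
    using subdegree_fps_exp_minus_1 by (subst fps_dvd_iff) auto
  thus ?thesis by (simp add: bernoulli_gf_def)
qed

lemma bernoulli_gf_nth_0: "bernoulli_gf $ 0 = 1"
proof -
  have "(bernoulli_gf * (fps_exp 1 - 1)) $ 1 = 1"
    by (simp add: bernoulli_gf_mult)
  thus ?thesis by (simp add: fps_mult_nth)
qed

lemma poly_bernoulli_gf_mult:
  "poly_bernoulli_gf k * (1 - fps_exp (-1)) = polylog_fps k oo (1 - fps_exp (-1))"
proof -
  have ne: "1 - fps_exp (-1::complex) \<noteq> 0"
    using subdegree_1_minus_fps_exp by force
  have "(polylog_fps k oo (1 - fps_exp (-1))) $ 0 = 0"
    by (simp add: polylog_fps_def)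
  hence "(1 - fps_exp (-1)) dvd (polylog_fps k oo (1 - fps_exp (-1)))"
    using ne subdegree_1_minus_fps_exp
    by (cases "(polylog_fps k oo (1 - fps_exp (-1))) = 0")
       (auto simp: fps_dvd_iff Suc_le_eq intro: subdegree_greaterI)
  thus ?thesis by (simp add: poly_bernoulli_gf_def)
qed

end

theory Submission
  imports Defs
begin

text \<open>
  Let \<open>B(t)\<close> be the Bernoulli series, \<open>P\<^sub>k(t) = Li\<^sub>k(u) / u\<close> with \<open>u = 1 - e\<^sup>-\<^sup>t\<close>, and
  \<open>G = B\<^sup>r P\<^sub>k e\<^sup>x\<^sup>t\<close>. One has \<open>t B' = (1 - B(-t)) B\<close> and \<open>t P\<^sub>k' = B (P\<^sub>k\<^sub>-\<^sub>1 - P\<^sub>k)\<close>, so the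
  product rule for \<open>t G'\<close> yields
  \<open>t G' = x t G + r (1 - B(-t)) G + B\<^sup>r\<^sup>+\<^sup>1 (P\<^sub>k\<^sub>-\<^sub>1 - P\<^sub>k) e\<^sup>x\<^sup>t\<close>.
  The theorem compares the coefficients of \<open>t\<^sup>n\<^sup>+\<^sup>1\<close>; the sum stops at \<open>l = n\<close> because
  \<open>1 - B(-t)\<close> has no constant term.
\<close>

text \<open>Power series do not form a field; for negative exponents the step rests on
  \<open>f * inverse f = 1\<close>, which the nonzero constant term guarantees.\<close>

lemma fps_power_int_add_1:
  fixes f :: "'a::field fps"
  assumes "f $ 0 \<noteq> 0"
  shows "f powi (r + 1) = f * f powi r"
proof (cases "r \<ge> 0")
  case True
  then show ?thesis
    by (simp add: power_int_def nat_add_distrib)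
next
  case False
  define m where "m = nat (- (r + 1))"
  have r: "r = - int (Suc m)" using False by (simp add: m_def)
  have "f * inverse f = 1"
    using assms by (rule inverse_mult_eq_1')
  then have "f * (inverse f * inverse f ^ m) = inverse f ^ m"
    by (simp flip: mult.assoc)
  \<comment> \<open>At \<open>m = 0\<close> the exponent \<open>r + 1\<close> is 0, where
    \<open>powi\<close> switches to its nonnegative branch.\<close>
  then show ?thesis
    by (cases "m = 0") (simp_all add: r power_int_def nat_add_distrib)
qed

text \<open>The extra factor \<open>f\<close> avoids the exponent \<open>r - 1\<close>, so that
  induction can run from 0 in both directions.\<close>

lemma fps_deriv_power_int:
  fixes f :: "'a::field fps"
  assumes "f $ 0 \<noteq> 0"
  shows "f * fps_deriv (f powi r) = of_int r * fps_deriv f * f powi r"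
proof -
  have step: "f * fps_deriv (f powi (i + 1)) = f * (fps_deriv f * f powi i + f * fps_deriv (f powi i))"
    for i
    unfolding fps_power_int_add_1[OF assms] fps_deriv_mult by (simp add: algebra_simps)
  have nz: "f \<noteq> 0" using assms by auto
  show ?thesis
  proof (induction r rule: int_induct[where k = 0])
    case base
    then show ?case by simp
  next
    case (step1 i)
    show ?case
      unfolding step fps_power_int_add_1[OF assms] using step1.IH by (simp add: algebra_simps)
  next
    \<comment> \<open>Going down, the product rule at \<open>i - 1\<close> is solved for the
      derivative of the lower power; this costs one more factor \<open>f\<close>, cancelled at the
      end.\<close>
    case (step2 i)
    have "f * (f * fps_deriv (f powi (i - 1))) = f * (of_int (i - 1) * fps_deriv f * f powi (i - 1))"
      using step[of "i - 1"] step2.IH fps_power_int_add_1[OF assms, of "i - 1"]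
      by (simp add: algebra_simps)
    then show ?case using nz by simp
  qed
qed

lemma fps_exp_mult_minus: "fps_exp 1 * fps_exp (-1) = (1 :: complex fps)"
  by (simp flip: fps_exp_add_mult)

text \<open>Substitute -t in B(t) (e^t - 1) = t; both sides change sign.\<close>

lemma bernoulli_gf_compose_minus:
  "(bernoulli_gf oo - fps_X) * (1 - fps_exp (-1)) = fps_X"
proof -
  have "(bernoulli_gf oo - fps_X) * ((fps_exp 1 - 1) oo - fps_X) = fps_X oo - fps_X"
    by (subst fps_compose_mult_distrib[symmetric]) (simp_all add: bernoulli_gf_mult)
  also have "(fps_exp 1 - 1) oo - fps_X = fps_exp (-1) - (1 :: complex fps)"
    by (simp add: fps_compose_sub_distrib)
  finally show ?thesis
    by (simp add: algebra_simps)
qed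

text \<open>Both sides give t when multiplied by the nonzero series 1 - e^-t.\<close>

lemma bernoulli_gf_times_exp: "bernoulli_gf * fps_exp 1 = bernoulli_gf oo - fps_X"
proof -
  have "bernoulli_gf * fps_exp 1 * (1 - fps_exp (-1)) =
      bernoulli_gf * (fps_exp 1 - fps_exp 1 * fps_exp (-1))"
    by (simp add: algebra_simps)
  also have "\<dots> = (bernoulli_gf oo - fps_X) * (1 - fps_exp (-1))"
    by (simp add: fps_exp_mult_minus bernoulli_gf_mult bernoulli_gf_compose_minus)
  finally show ?thesis
    using subdegree_1_minus_fps_exp by (auto simp: mult_cancel_right)
qed

text \<open>Differentiate B (e^t - 1) = t, multiply by t, write the t on the right as B (e^t - 1)
  again, and cancel e^t - 1.\<close>

lemma bernoulli_gf_deriv: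
  "fps_X * fps_deriv bernoulli_gf = (1 - (bernoulli_gf oo - fps_X)) * bernoulli_gf"
proof -
  let ?E = "fps_exp 1 :: complex fps"
  have "fps_deriv (bernoulli_gf * (?E - 1)) = 1"
    by (simp add: bernoulli_gf_mult)
  then have "fps_deriv bernoulli_gf * (?E - 1) = 1 - bernoulli_gf * ?E"
    by (simp add: algebra_simps)
  then have "fps_X * fps_deriv bernoulli_gf * (?E - 1) = fps_X * (1 - bernoulli_gf * ?E)"
    by (simp add: mult.assoc)
  also have "\<dots> = (1 - (bernoulli_gf oo - fps_X)) * bernoulli_gf * (?E - 1)"
    by (simp add: bernoulli_gf_times_exp mult.assoc bernoulli_gf_mult mult.commute)
  finally show ?thesis
    using subdegree_fps_exp_minus_1 by (auto simp: mult_cancel_right)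
qed

lemma bernoulli_gf_power_int_deriv:
  "fps_X * fps_deriv (bernoulli_gf powi r) =
     of_int r * (1 - (bernoulli_gf oo - fps_X)) * bernoulli_gf powi r"
proof -
  have "bernoulli_gf * (fps_X * fps_deriv (bernoulli_gf powi r)) =
      fps_X * (bernoulli_gf * fps_deriv (bernoulli_gf powi r))"
    by (simp add: mult_ac)
  also have "\<dots> = of_int r * (fps_X * fps_deriv bernoulli_gf) * bernoulli_gf powi r"
    by (simp add: fps_deriv_power_int bernoulli_gf_nth_0 mult_ac)
  also have "\<dots> = bernoulli_gf * (of_int r * (1 - (bernoulli_gf oo - fps_X)) * bernoulli_gf powi r)"
    by (simp add: bernoulli_gf_deriv mult_ac)
  finally show ?thesis
    using bernoulli_gf_nth_0 by (auto simp: mult_cancel_left)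
qed

text \<open>For n > 0 this is n / n^k = 1 / n^(k-1). The constant term fixed at 0 matters for
  \<open>k = 1\<close>, since \<open>0 powi 0\<close> is 1.\<close>

lemma polylog_fps_deriv: "fps_X * fps_deriv (polylog_fps k) = polylog_fps (k - 1)"
  by (rule fps_ext) (auto simp: polylog_fps_def power_int_diff simp del: of_nat_Suc)

text \<open>Differentiate P_k u = Li_k(u), where u' = e^-t. The quotient e^-t / u that arises equals
  B / t.\<close>

lemma poly_bernoulli_gf_deriv:
  "fps_X * fps_deriv (poly_bernoulli_gf k) =
     bernoulli_gf * (poly_bernoulli_gf (k - 1) - poly_bernoulli_gf k)"
proof -
  let ?E = "fps_exp (-1) :: complex fps"
  let ?u = "1 - ?E"
  have E: "fps_const (-1) = (-1 :: complex fps)"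
    by (simp flip: fps_const_neg)
  have u: "?u \<noteq> 0" using subdegree_1_minus_fps_exp by force
  \<comment> \<open>Putting u into t Li_k' = Li_(k-1) and dividing by u identifies Li_k'(u) as
    P_(k-1).\<close>
  have "(fps_deriv (polylog_fps k) oo ?u) * ?u = (fps_X * fps_deriv (polylog_fps k)) oo ?u"
    by (simp add: fps_compose_mult_distrib mult.commute)
  also have "\<dots> = poly_bernoulli_gf (k - 1) * ?u"
    by (simp add: polylog_fps_deriv poly_bernoulli_gf_mult)
  finally have L: "fps_deriv (polylog_fps k) oo ?u = poly_bernoulli_gf (k - 1)"
    using u by simp
  have "fps_deriv (poly_bernoulli_gf k * ?u) = poly_bernoulli_gf (k - 1) * ?E"
    unfolding poly_bernoulli_gf_mult by (simp add: fps_compose_deriv L E)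
  then have P: "fps_deriv (poly_bernoulli_gf k) * ?u =
      ?E * (poly_bernoulli_gf (k - 1) - poly_bernoulli_gf k)"
    by (simp add: E algebra_simps)
  have "bernoulli_gf * ?u = bernoulli_gf * (fps_exp 1 * ?E - ?E)"
    by (simp add: fps_exp_mult_minus)
  also have "\<dots> = bernoulli_gf * (fps_exp 1 - 1) * ?E"
    by (simp add: algebra_simps)
  also have "\<dots> = fps_X * ?E"
    by (simp add: bernoulli_gf_mult)
  finally have B: "bernoulli_gf * ?u = fps_X * ?E" .
  have "fps_X * fps_deriv (poly_bernoulli_gf k) * ?u =
      fps_X * ?E * (poly_bernoulli_gf (k - 1) - poly_bernoulli_gf k)"
    by (simp add: P mult.assoc)
  also have "\<dots> = bernoulli_gf * (poly_bernoulli_gf (k - 1) - poly_bernoulli_gf k) * ?u"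
    unfolding B[symmetric] by (simp add: mult_ac)
  finally show ?thesis using u by simp
qed

lemma const_poly_fps_nth [simp]: "const_poly_fps F $ n = [:F $ n:]"
  by (simp add: const_poly_fps_def)

text \<open>The embedding respects ring operations and derivation, so identities between scalar
  series carry over to polynomial coefficients.\<close>

lemma const_poly_fps_diff: "const_poly_fps (F - G) = const_poly_fps F - const_poly_fps G"
  by (simp add: fps_eq_iff)

lemma const_poly_fps_mult: "const_poly_fps (F * G) = const_poly_fps F * const_poly_fps G"
  by (simp add: fps_eq_iff fps_mult_nth sum_to_poly mult.commute)

lemma const_poly_fps_deriv: "const_poly_fps (fps_deriv F) = fps_deriv (const_poly_fps F)"
  by (simp add: fps_eq_iff of_nat_poly)

lemma const_poly_fps_X: "const_poly_fps fps_X = fps_X"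
  by (simp add: fps_eq_iff fps_X_def)

text \<open>Derivation is in t; the polynomial \<open>[:0, 1:]\<close>, that is x, acts as a
  scalar.\<close>

lemma exp_xt_deriv: "fps_deriv exp_xt = fps_const [:0, 1:] * exp_xt"
proof (rule fps_ext)
  fix n
  have "monom (1 / fact n) (Suc n) = of_nat (Suc n) * (monom (1 / fact (Suc n)) (Suc n) :: complex poly)"
    by (simp add: of_nat_poly smult_monom del: of_nat_Suc)
  then show "fps_deriv exp_xt $ n = (fps_const [:0, 1:] * exp_xt) $ n"
    by (simp add: exp_xt_def monom_Suc del: of_nat_Suc)
qed

lemma smult_sum_right: "smult c (sum f A) = (\<Sum>x\<in>A. smult c (f x))"
  by (induction A rule: infinite_finite_induct) (simp_all add: smult_add_right)

definition mixed_gf :: "int \<Rightarrow> int \<Rightarrow> complex poly fps" where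
  "mixed_gf r k = const_poly_fps (bernoulli_gf powi r) *
                  const_poly_fps (poly_bernoulli_gf k) * exp_xt"

lemma mixed_poly_eq: "mixed_poly r k n = smult (fact n) (mixed_gf r k $ n)"
  by (simp add: mixed_poly_def mixed_gf_def)

lemma mixed_gf_nth: "mixed_gf r k $ n = smult (1 / fact n) (mixed_poly r k n)"
  by (simp add: mixed_poly_eq)

lemma mixed_gf_deriv:
  "fps_X * fps_deriv (mixed_gf r k) =
     fps_X * (fps_const [:0, 1:] * mixed_gf r k)
     + const_poly_fps (of_int r * (1 - (bernoulli_gf oo - fps_X))) * mixed_gf r k
     + (mixed_gf (r + 1) (k - 1) - mixed_gf (r + 1) k)"
proof -
  let ?C = const_poly_fps
  let ?B = "?C (bernoulli_gf powi r)" and ?P = "?C (poly_bernoulli_gf k)"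
  have B: "fps_X * fps_deriv ?B = ?C (of_int r * (1 - (bernoulli_gf oo - fps_X))) * ?B"
    by (simp only: const_poly_fps_mult[symmetric] const_poly_fps_X[symmetric]
        const_poly_fps_deriv[symmetric] bernoulli_gf_power_int_deriv)
  have P: "fps_X * fps_deriv ?P = ?C bernoulli_gf * (?C (poly_bernoulli_gf (k - 1)) - ?P)"
    by (simp only: const_poly_fps_mult[symmetric] const_poly_fps_X[symmetric]
        const_poly_fps_deriv[symmetric] const_poly_fps_diff[symmetric] poly_bernoulli_gf_deriv)
  \<comment> \<open>The factor B produced by t P_k' joins B^r; this is where the index r + 1 comes
    from.\<close>
  have B1: "?C (bernoulli_gf powi (r + 1)) = ?C bernoulli_gf * ?B"
    by (simp add: fps_power_int_add_1 bernoulli_gf_nth_0 const_poly_fps_mult)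
  have "fps_X * fps_deriv (mixed_gf r k) =
      (fps_X * fps_deriv ?B) * ?P * exp_xt + ?B * (fps_X * fps_deriv ?P) * exp_xt
      + ?B * ?P * (fps_X * fps_deriv exp_xt)"
    unfolding mixed_gf_def fps_deriv_mult by (simp only: algebra_simps)
  also have "\<dots> = fps_X * (fps_const [:0, 1:] * mixed_gf r k)
     + ?C (of_int r * (1 - (bernoulli_gf oo - fps_X))) * mixed_gf r k
     + (mixed_gf (r + 1) (k - 1) - mixed_gf (r + 1) k)"
    unfolding B P mixed_gf_def exp_xt_deriv B1 by (simp only: algebra_simps)
  finally show ?thesis .
qed

text \<open>Substituting -t brings the sign (-1)^m, and the constant term 1 of B cancels the leading
  1.\<close>

lemma one_minus_bernoulli_gf_compose_minus_nth:
  "(1 - (bernoulli_gf oo - fps_X)) $ m =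
     (if m = 0 then 0 else - ((-1) ^ m * bernoulli_number m / fact m))"
  by (simp add: fps_compose_uminus' bernoulli_number_def bernoulli_gf_nth_0)

theorem theorem2:
  fixes r k :: int and n :: nat
  shows "mixed_poly r k (n + 1) =
           [:0, 1:] * mixed_poly r k n
           - smult (of_int r / of_nat (n + 1))
               (\<Sum>l=0..n. smult (of_nat ((n + 1) choose l) * (-1) ^ (n + 1 - l) *
                                 bernoulli_number (n + 1 - l))
                            (mixed_poly r k l))
           - smult (1 / of_nat (n + 1))
               (mixed_poly (r + 1) k (n + 1) - mixed_poly (r + 1) (k - 1) (n + 1))"
proof -
  let ?D = "1 - (bernoulli_gf oo - fps_X)"
  let ?S = "\<Sum>l=0..n. smult (of_nat ((n + 1) choose l) * (-1) ^ (n + 1 - l) *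
                              bernoulli_number (n + 1 - l)) (mixed_poly r k l)"
  have C: "(of_int r * ?D) $ m = of_int r * ?D $ m" for m
    by (simp flip: fps_of_int)
  have "(const_poly_fps (of_int r * ?D) * mixed_gf r k) $ (n + 1) =
      (\<Sum>l=0..n + 1. mixed_gf r k $ l * [:of_int r * ?D $ (n + 1 - l):])"
    \<comment> \<open>The factors are swapped so that \<open>l\<close> indexes the coefficients of
      \<open>mixed_gf\<close>, as in the goal.\<close>
    by (simp only: mult.commute[of "const_poly_fps (of_int r * ?D)"]
        fps_mult_nth[of "mixed_gf r k"] const_poly_fps_nth C)
  also have "\<dots> = (\<Sum>l=0..n. mixed_gf r k $ l * [:of_int r * ?D $ (n + 1 - l):])"
    by (simp add: bernoulli_gf_nth_0)
  also have "\<dots> = (\<Sum>l=0..n. smult (- of_int r / fact (n + 1))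
      (smult (of_nat ((n + 1) choose l) * (-1) ^ (n + 1 - l) * bernoulli_number (n + 1 - l))
        (mixed_poly r k l)))"
  proof (rule sum.cong[OF refl])
    fix l assume "l \<in> {0..n}"
    then have l: "l \<le> n + 1" "n + 1 - l \<noteq> 0" by auto
    \<comment> \<open>The factorials 1 / (l! (n+1-l)!) combine to the binomial coefficient over
      (n+1)!.\<close>
    show "mixed_gf r k $ l * [:of_int r * ?D $ (n + 1 - l):] =
      smult (- of_int r / fact (n + 1))
      (smult (of_nat ((n + 1) choose l) * (-1) ^ (n + 1 - l) * bernoulli_number (n + 1 - l))
        (mixed_poly r k l))"
      unfolding one_minus_bernoulli_gf_compose_minus_nth if_not_P[OF l(2)]
        binomial_fact[OF l(1)] mixed_gf_nth
      by (simp add: field_simps del: fact_Suc)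
  qed
  finally have sum: "(const_poly_fps (of_int r * ?D) * mixed_gf r k) $ (n + 1) =
      smult (- of_int r / fact (n + 1)) ?S"
    by (simp only: smult_sum_right)
  \<comment> \<open>Here t G' contributes the factor n + 1, and (n+1) / (n+1)! = 1 / n!.\<close>
  have "(fps_X * fps_deriv (mixed_gf r k)) $ (n + 1) = smult (1 / fact n) (mixed_poly r k (n + 1))"
    by (simp add: mixed_gf_nth of_nat_poly del: of_nat_Suc)
  then have "smult (1 / fact n) (mixed_poly r k (n + 1)) =
      smult (1 / fact n) ([:0, 1:] * mixed_poly r k n)
      + smult (- of_int r / fact (n + 1)) ?S
      + smult (1 / fact (n + 1)) (mixed_poly (r + 1) (k - 1) (n + 1) - mixed_poly (r + 1) k (n + 1))"
    unfolding mixed_gf_deriv fps_add_nth sum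
    by (simp add: mixed_gf_nth smult_diff_right del: fact_Suc)
  \<comment> \<open>Scaling by n! turns each 1 / (n+1)! into the 1 / (n+1) of the claim.\<close>
  then have "smult (fact n) (smult (1 / fact n) (mixed_poly r k (n + 1))) =
      smult (fact n) (smult (1 / fact n) ([:0, 1:] * mixed_poly r k n)
      + smult (- of_int r / fact (n + 1)) ?S
      + smult (1 / fact (n + 1)) (mixed_poly (r + 1) (k - 1) (n + 1) - mixed_poly (r + 1) k (n + 1)))"
    by (rule arg_cong)
  then show ?thesis
    by (simp add: smult_add_right smult_diff_right del: of_nat_Suc)
qed

end
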